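(* Let $f\colon P\to Q$ be a connected quandle homomorphism and put $H_f=\mathrm{Inn}_{\mathrm{rel}}(f)/\mathrm{Trans}_{\mathrm{rel}}(f)$. Then the natural homomorphism $$\mathrm{Inn}_{\mathrm{rel}}(f)/[\mathrm{Inn}(P),\mathrm{Inn}_{\mathrm{rel}}(f)]\longrightarrow H_f$$ is an isomorphism. In particular, $H_f=1$ if and only if $\mathrm{Inn}_{\mathrm{rel}}(f)$ is $\mathrm{Inn}(P)$-perfect, i.e. $[\mathrm{Inn}(P),\mathrm{Inn}_{\mathrm{rel}}(f)]=\mathrm{Inn}_{\mathrm{rel}}(f)$.
   Context: A quandle is a set $Q$ with bijections $s_x\colon Q\to Q$ ($x\in Q$) such that $s_x(x)=x$ and $s_x\circ s_y=s_{s_x(y)}\circ s_x$ for all $x,y\in Q$. A quandle homomorphism $f\colon P\to Q$ is a map with $f(s_x(y))=s_{f(x)}(f(y))$ for all $x,y\in P$. The inner automorphism group $\mathrm{Inn}(P)$ is the group of permutations of $P$ generated by all $s_x$, $x\in P$. A surjective quandle homomorphism $f\colon P\to Q$ induces a surjective group homomorphism $f_*\colon\mathrm{Inn}(P)\to\mathrm{Inn}(Q)$, where $f_*(\varphi)$ is the unique element of $\mathrm{Inn}(Q)$ with $f\circ\varphi=f_*(\varphi)\circ f$. Put $\mathrm{Inn}_{\mathrm{rel}}(f)=\ker(f_* )$; it preserves each fiber of $f$. The homomorphism $f$ is connected if it is surjective and for each $q\in Q$ the group $\mathrm{Inn}_{\mathrm{rel}}(f)$ acts transitively on $f^{-1}(q)$.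 Put $\mathrm{Trans}_{\mathrm{rel}}(f)=\langle s_xs_y^{-1}\mid x,y\in P,\ f(x)=f(y)\rangle$, a normal subgroup of $\mathrm{Inn}(P)$ contained in $\mathrm{Inn}_{\mathrm{rel}}(f)$. One has $[\mathrm{Inn}(P),\mathrm{Inn}_{\mathrm{rel}}(f)]\subseteq\mathrm{Trans}_{\mathrm{rel}}(f)$, and the natural homomorphism is the one induced by the identity of $\mathrm{Inn}_{\mathrm{rel}}(f)$. *)

theory Defs
  imports "HOL-Algebra.Algebra"
begin

section \<open>Quandles\<close>

record 'a quandle_struct = "'a partial_object" +
  pt_sym :: "'a \<Rightarrow> 'a \<Rightarrow> 'a"

text \<open>
  \<open>pt_sym Q x\<close> is the bijection \<open>s\<^sub>x\<close>; only its values on the carrier are meaningful.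
  The carrier may be empty.
\<close>

locale quandle =
  fixes Q :: "('a, 'm) quandle_struct_scheme" (structure)
  assumes pt_sym_bij: "x \<in> carrier Q \<Longrightarrow> bij_betw (pt_sym Q x) (carrier Q) (carrier Q)"
    and pt_sym_fix: "x \<in> carrier Q \<Longrightarrow> pt_sym Q x x = x"
    and pt_sym_distrib: "\<lbrakk>x \<in> carrier Q; y \<in> carrier Q; z \<in> carrier Q\<rbrakk> \<Longrightarrow>
      pt_sym Q x (pt_sym Q y z) = pt_sym Q (pt_sym Q x y) (pt_sym Q x z)"

locale quandle_hom = P: quandle P + Q: quandle Q
  for P :: "('a, 'm) quandle_struct_scheme" and Q :: "('b, 'n) quandle_struct_scheme" +
  fixes f :: "'a \<Rightarrow> 'b"
  assumes f_closed: "f \<in> carrier P \<rightarrow> carrier Q"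
    and f_pt_sym: "\<lbrakk>x \<in> carrier P; y \<in> carrier P\<rbrakk> \<Longrightarrow>
      f (pt_sym P x y) = pt_sym Q (f x) (f y)"

section \<open>Inner automorphism groups\<close>

definition inner_perm :: "('a, 'm) quandle_struct_scheme \<Rightarrow> 'a \<Rightarrow> 'a \<Rightarrow> 'a"
  where "inner_perm P x = restrict (pt_sym P x) (carrier P)"

definition Inn :: "('a, 'm) quandle_struct_scheme \<Rightarrow> ('a \<Rightarrow> 'a) monoid"
  where "Inn P = BijGroup (carrier P)
    \<lparr>carrier := generate (BijGroup (carrier P)) (inner_perm P ` carrier P)\<rparr>"

text \<open>The map \<open>f\<^sub>*\<close>; it is well defined when \<open>f\<close> is a surjective homomorphism.\<close>

definition Inn_map :: "('a, 'm) quandle_struct_scheme \<Rightarrow> ('b, 'n) quandle_struct_scheme \<Rightarrow>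
    ('a \<Rightarrow> 'b) \<Rightarrow> ('a \<Rightarrow> 'a) \<Rightarrow> ('b \<Rightarrow> 'b)"
  where "Inn_map P Q f \<phi> =
    (THE \<psi>. \<psi> \<in> carrier (Inn Q) \<and> (\<forall>x\<in>carrier P. f (\<phi> x) = \<psi> (f x)))"

definition Inn_rel :: "('a, 'm) quandle_struct_scheme \<Rightarrow> ('b, 'n) quandle_struct_scheme \<Rightarrow>
    ('a \<Rightarrow> 'b) \<Rightarrow> ('a \<Rightarrow> 'a) set"
  where "Inn_rel P Q f = kernel (Inn P) (Inn Q) (Inn_map P Q f)"

definition Inn_rel_group :: "('a, 'm) quandle_struct_scheme \<Rightarrow> ('b, 'n) quandle_struct_scheme \<Rightarrow>
    ('a \<Rightarrow> 'b) \<Rightarrow> ('a \<Rightarrow> 'a) monoid"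
  where "Inn_rel_group P Q f = Inn P\<lparr>carrier := Inn_rel P Q f\<rparr>"

definition Trans_rel :: "('a, 'm) quandle_struct_scheme \<Rightarrow> ('a \<Rightarrow> 'b) \<Rightarrow> ('a \<Rightarrow> 'a) set"
  where "Trans_rel P f = generate (Inn P)
    {inner_perm P x \<otimes>\<^bsub>Inn P\<^esub> inv\<^bsub>Inn P\<^esub> (inner_perm P y) | x y.
      x \<in> carrier P \<and> y \<in> carrier P \<and> f x = f y}"

definition fiber :: "('a, 'm) quandle_struct_scheme \<Rightarrow> ('a \<Rightarrow> 'b) \<Rightarrow> 'b \<Rightarrow> 'a set"
  where "fiber P f q = {x \<in> carrier P. f x = q}"

text \<open>
  Elements of \<open>Inn_rel P Q f\<close> are permutations of all of \<open>P\<close>; they act on a fiber by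
  restriction.
\<close>

locale connected_quandle_hom = quandle_hom +
  assumes f_surj: "f ` carrier P = carrier Q"
    and fiber_transitive: "q \<in> carrier Q \<Longrightarrow>
      transitive_action (Inn_rel_group P Q f) (fiber P f q) (\<lambda>\<phi>. restrict \<phi> (fiber P f q))"

section \<open>Commutators and maps between quotients\<close>

definition commutator_subgroup :: "('a, 'm) monoid_scheme \<Rightarrow> 'a set \<Rightarrow> 'a set \<Rightarrow> 'a set"
  where "commutator_subgroup G H K = generate G
    {h \<otimes>\<^bsub>G\<^esub> k \<otimes>\<^bsub>G\<^esub> inv\<^bsub>G\<^esub> h \<otimes>\<^bsub>G\<^esub> inv\<^bsub>G\<^esub> k | h k. h \<in> H \<and> k \<in> K}"

definition relatively_perfect :: "('a, 'm) monoid_scheme \<Rightarrow> 'a set \<Rightarrow> bool"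
  where "relatively_perfect G N \<longleftrightarrow> commutator_subgroup G (carrier G) N = N"

text \<open>
  The map \<open>G Mod N \<rightarrow> G Mod M\<close> induced by the identity of \<open>G\<close>; it is well defined
  when \<open>N \<subseteq> M\<close>, see \<open>natural_map_coset\<close>.
\<close>

definition natural_map :: "('a, 'm) monoid_scheme \<Rightarrow> 'a set \<Rightarrow> 'a set \<Rightarrow> 'a set \<Rightarrow> 'a set"
  where "natural_map G N M C =
    (THE D. \<exists>g\<in>carrier G. C = N #>\<^bsub>G\<^esub> g \<and> D = M #>\<^bsub>G\<^esub> g)"

definition H_quot :: "('a, 'm) quandle_struct_scheme \<Rightarrow> ('b, 'n) quandle_struct_scheme \<Rightarrow>
    ('a \<Rightarrow> 'b) \<Rightarrow> ('a \<Rightarrow> 'a) set monoid"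
  where "H_quot P Q f = Inn_rel_group P Q f Mod Trans_rel P f"

lemma (in group) natural_map_coset:
  assumes N: "subgroup N G" and M: "subgroup M G" and sub: "N \<subseteq> M" and g: "g \<in> carrier G"
  shows "natural_map G N M (N #> g) = M #> g"
  unfolding natural_map_def
proof (rule the_equality)
  show "\<exists>g'\<in>carrier G. N #> g = N #> g' \<and> M #> g = M #> g'"
    using g by blast
next
  fix D assume "\<exists>g'\<in>carrier G. N #> g = N #> g' \<and> D = M #> g'"
  then obtain g' where g': "g' \<in> carrier G" "N #> g = N #> g'" "D = M #> g'"
    by blast
  have "g' \<in> M #> g"
    using rcos_self[OF g'(1) N] g'(2) sub by (auto simp: r_coset_def)
  then show "D = M #> g"
    using repr_independence[OF _ g M] g'(3) by simp
qed

section \<open>Well-definedness\<close>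

context quandle
begin

lemma inner_perm_Bij: "x \<in> carrier Q \<Longrightarrow> inner_perm Q x \<in> carrier (BijGroup (carrier Q))"
  using pt_sym_bij by (auto simp: BijGroup_def Bij_def inner_perm_def cong: bij_betw_cong)

lemma Inn_subgroup: "subgroup (carrier (Inn Q)) (BijGroup (carrier Q))"
  using group.generate_is_subgroup[OF group_BijGroup, of "inner_perm Q ` carrier Q"] inner_perm_Bij
  by (auto simp: Inn_def)

lemma group_Inn: "group (Inn Q)"
  using group.subgroup_imp_group[OF group_BijGroup Inn_subgroup]
  by (simp add: Inn_def)

end

lemma BijGroup_mult_apply:
  assumes "g \<in> carrier (BijGroup S)" "h \<in> carrier (BijGroup S)" "x \<in> S"
  shows "(g \<otimes>\<^bsub>BijGroup S\<^esub> h) x = g (h x)"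
  using assms by (simp add: BijGroup_def compose_def)

lemma BijGroup_apply_closed: "g \<in> carrier (BijGroup S) \<Longrightarrow> x \<in> S \<Longrightarrow> g x \<in> S"
  using Bij_imp_funcset by (fastforce simp: BijGroup_def)

lemma BijGroup_one_apply: "x \<in> S \<Longrightarrow> \<one>\<^bsub>BijGroup S\<^esub> x = x"
  by (simp add: BijGroup_def)

lemma (in quandle_hom) Inn_map_unique:
  assumes surj: "f ` carrier P = carrier Q" and \<phi>: "\<phi> \<in> carrier (Inn P)"
  shows "\<exists>!\<psi>. \<psi> \<in> carrier (Inn Q) \<and> (\<forall>x\<in>carrier P. f (\<phi> x) = \<psi> (f x))"
proof (rule ex_ex1I)
  let ?BP = "BijGroup (carrier P)" and ?BQ = "BijGroup (carrier Q)"
  interpret BP: group ?BP by (rule group_BijGroup)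
  interpret BQ: group ?BQ by (rule group_BijGroup)
  interpret SQ: subgroup "carrier (Inn Q)" ?BQ by (rule Q.Inn_subgroup)
  note app = BijGroup_mult_apply and closed = BijGroup_apply_closed and one = BijGroup_one_apply
  have gen: "inner_perm P ` carrier P \<subseteq> carrier ?BP"
    using P.inner_perm_Bij by blast
  have perm: "inner_perm Q (f x) \<in> carrier (Inn Q)" if "x \<in> carrier P" for x
    using that f_closed by (auto simp: Inn_def intro: generate.incl)
  have perm_f: "f (inner_perm P x y) = inner_perm Q (f x) (f y)"
    if "x \<in> carrier P" "y \<in> carrier P" for x y
    using that f_closed f_pt_sym by (auto simp: inner_perm_def)
  have "\<phi> \<in> generate ?BP (inner_perm P ` carrier P)"
    using \<phi> by (simp add: Inn_def)
  then show "\<exists>\<psi>. \<psi> \<in> carrier (Inn Q) \<and> (\<forall>x\<in>carrier P. f (\<phi> x) = \<psi> (f x))"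
  proof induction
    case one
    have "\<forall>x\<in>carrier P. f (\<one>\<^bsub>?BP\<^esub> x) = \<one>\<^bsub>?BQ\<^esub> (f x)"
      using f_closed by (auto simp: BijGroup_def)
    then show ?case using SQ.one_closed by blast
  next
    case (incl h)
    then show ?case using perm perm_f by blast
  next
    case (inv h)
    then obtain x where x: "x \<in> carrier P" and h: "h = inner_perm P x" by blast
    let ?k = "inner_perm Q (f x)"
    have hB: "h \<in> carrier ?BP" and kB: "?k \<in> carrier ?BQ"
      using x h P.inner_perm_Bij Q.inner_perm_Bij f_closed by auto
    have "f ((inv\<^bsub>?BP\<^esub> h) y) = (inv\<^bsub>?BQ\<^esub> ?k) (f y)" if y: "y \<in> carrier P" for y
    proof -
      define z where "z = (inv\<^bsub>?BP\<^esub> h) y"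
      have z: "z \<in> carrier P"
        unfolding z_def using closed[of "inv\<^bsub>?BP\<^esub> h"] hB y by simp
      have "h z = y"
        using app[of h "carrier P" "inv\<^bsub>?BP\<^esub> h" y] hB y
        by (simp add: z_def one)
      then have fy: "f y = ?k (f z)" using perm_f[OF x z] h by simp
      have fz: "f z \<in> carrier Q" using z f_closed by auto
      from fy have "(inv\<^bsub>?BQ\<^esub> ?k) (f y) = (inv\<^bsub>?BQ\<^esub> ?k \<otimes>\<^bsub>?BQ\<^esub> ?k) (f z)"
        using app[of "inv\<^bsub>?BQ\<^esub> ?k" "carrier Q" ?k "f z"] kB fz
        by (metis BQ.inv_closed)
      also have "\<dots> = f z" using kB fz by (simp add: one)
      finally show ?thesis by (simp add: z_def)
    qed
    moreover have "inv\<^bsub>?BQ\<^esub> ?k \<in> carrier (Inn Q)"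
      using perm[OF x] by (rule SQ.m_inv_closed)
    ultimately show ?case by blast
  next
    case (eng h1 h2)
    then obtain k1 k2 where k1: "k1 \<in> carrier (Inn Q)" "\<forall>x\<in>carrier P. f (h1 x) = k1 (f x)"
      and k2: "k2 \<in> carrier (Inn Q)" "\<forall>x\<in>carrier P. f (h2 x) = k2 (f x)" by blast
    have hB: "h1 \<in> carrier ?BP" "h2 \<in> carrier ?BP"
      using eng.hyps BP.generate_incl[OF gen] by auto
    have "f ((h1 \<otimes>\<^bsub>?BP\<^esub> h2) x) = (k1 \<otimes>\<^bsub>?BQ\<^esub> k2) (f x)" if x: "x \<in> carrier P" for x
      using app[OF hB x] app[OF SQ.mem_carrier[OF k1(1)] SQ.mem_carrier[OF k2(1)], of "f x"]
        closed[OF hB(2) x] k1(2) k2(2) x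
        funcset_mem[OF f_closed x] by simp
    then show ?case using SQ.m_closed[OF k1(1) k2(1)] by blast
  qed
next
  fix \<psi> \<psi>'
  assume a: "\<psi> \<in> carrier (Inn Q) \<and> (\<forall>x\<in>carrier P. f (\<phi> x) = \<psi> (f x))"
    and b: "\<psi>' \<in> carrier (Inn Q) \<and> (\<forall>x\<in>carrier P. f (\<phi> x) = \<psi>' (f x))"
  have "\<psi> \<in> extensional (carrier Q)" "\<psi>' \<in> extensional (carrier Q)"
    using a b subgroup.mem_carrier[OF Q.Inn_subgroup] by (auto simp: BijGroup_def Bij_def)
  then show "\<psi> = \<psi>'"
  proof (rule extensionalityI)
    fix y assume "y \<in> carrier Q"
    then obtain x where "x \<in> carrier P" "y = f x" using surj by blast
    then show "\<psi> y = \<psi>' y" using a b by metis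
  qed
qed

end

theory Submission
  imports Defs
begin

text \<open>
  The two subgroups coincide: \<open>[Inn(P), Inn\<^sub>r\<^sub>e\<^sub>l(f)] = Trans\<^sub>r\<^sub>e\<^sub>l(f)\<close>. Everything rests on
  \<open>g s\<^sub>x g\<inverse> = s\<^bsub>g(x)\<^esub>\<close> for \<open>g\<close> in \<open>Inn(P)\<close>. If \<open>k\<close> is in
  \<open>Inn\<^sub>r\<^sub>e\<^sub>l(f)\<close>, then \<open>[s\<^sub>x, k] = s\<^sub>x s\<^bsub>k(x)\<^esub>\<inverse>\<close> is a generator of \<open>Trans\<^sub>r\<^sub>e\<^sub>l(f)\<close>, and
  since that subgroup is normal it suffices to treat the generators \<open>s\<^sub>x\<close> of \<open>Inn(P)\<close>. Conversely,
  if \<open>f(x) = f(y)\<close>, connectedness gives \<open>g\<close> in \<open>Inn\<^sub>r\<^sub>e\<^sub>l(f)\<close> with \<open>g(y) = x\<close>, and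
  \<open>s\<^sub>x s\<^sub>y\<inverse> = [g, s\<^sub>y] = [s\<^sub>y, g]\<inverse>\<close>.
\<close>

section \<open>Normal subgroups, quotients and commutators\<close>

context group
begin

text \<open>This case suffices because the two subgroups to be factored out turn out to be equal. On
  the cosets of \<open>N\<close> the map is then the identity.\<close>

lemma natural_map_refl_iso:
  assumes "N \<lhd> G"
  shows "natural_map G N N \<in> iso (G Mod N) (G Mod N)"
proof -
  interpret N: normal N G by fact
  have "C = natural_map G N N C" if "C \<in> carrier (G Mod N)" for C
    using that natural_map_coset[OF N.is_subgroup N.is_subgroup] by (auto simp: FactGroup_def RCOSETS_def)
  moreover have "(\<lambda>C. C) \<in> iso (G Mod N) (G Mod N)"
    by (rule iso_set_refl)
  moreover have "Group.group (G Mod N)"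
    by (rule N.factorgroup_is_group)
  ultimately show ?thesis
    by (metis (no_types, lifting) group.iso_eq)
qed

lemma trivial_group_Mod_iff:
  assumes "N \<lhd> G"
  shows "trivial_group (G Mod N) \<longleftrightarrow> N = carrier G"
proof -
  interpret N: normal N G by fact
  have "trivial_group (G Mod N) \<longleftrightarrow> rcosets N = {N}"
    using N.factorgroup_is_group by (auto simp: trivial_group_def FactGroup_def)
  also have "\<dots> \<longleftrightarrow> N = carrier G"
  proof
    assume *: "rcosets N = {N}"
    have "g \<in> N" if g: "g \<in> carrier G" for g
    proof -
      have "N #> g \<in> rcosets N" using g by (auto simp: RCOSETS_def)
      then show ?thesis using * rcos_self[OF g N.is_subgroup] by auto
    qed
    then show "N = carrier G" using N.subset by blast
  next
    assume "N = carrier G"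
    then show "rcosets N = {N}"
      using coset_join2[OF _ N.is_subgroup] by (auto simp: RCOSETS_def)
  qed
  finally show ?thesis .
qed

text \<open>Cancellation in front of a further factor, the shape left once \<open>m_assoc\<close>
  has moved all brackets to the right.\<close>

lemma inv_mult_cancel:
  assumes "x \<in> carrier G" "y \<in> carrier G"
  shows "inv x \<otimes> (x \<otimes> y) = y" "x \<otimes> (inv x \<otimes> y) = y"
  using assms by (simp_all flip: m_assoc)

text \<open>For fixed \<open>k\<close>, having a commutator with \<open>k\<close> in
  \<open>N\<close> passes from elements of \<open>S\<close> to their inverses and to products,
  because \<open>N\<close> absorbs conjugation.\<close>

lemma commutator_subset_normal:
  assumes S: "S \<subseteq> carrier G" and N: "N \<lhd> G" and K: "K \<subseteq> carrier G"
    and comm: "\<And>s k. \<lbrakk>s \<in> S; k \<in> K\<rbrakk> \<Longrightarrow> s \<otimes> k \<otimes> inv s \<otimes> inv k \<in> N"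
  shows "commutator_subgroup G (generate G S) K \<subseteq> N"
proof -
  interpret N: normal N G by fact
  have "h \<otimes> k \<otimes> inv h \<otimes> inv k \<in> N" if "h \<in> generate G S" "k \<in> K" for h k
    using that(1)
  proof induction
    case one
    have "k \<in> carrier G" using that(2) K by blast
    then show ?case by simp
  next
    case (incl h)
    then show ?case using comm that(2) by blast
  next
    case (inv h)
    have c: "h \<in> carrier G" "k \<in> carrier G" using inv S that(2) K by auto
    \<comment> \<open>\<open>[inv h, k]\<close> is the conjugate of the inverse of
      \<open>[h, k]\<close> by \<open>inv h\<close>.\<close>
    have "inv h \<otimes> inv (h \<otimes> k \<otimes> inv h \<otimes> inv k) \<otimes> h \<in> N"
      using N.inv_op_closed1 c comm[OF inv that(2)] by simp
    also have "inv h \<otimes> inv (h \<otimes> k \<otimes> inv h \<otimes> inv k) \<otimes> h = inv h \<otimes> k \<otimes> inv (inv h) \<otimes> inv k"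
      using c by (simp add: inv_mult_group m_assoc)
    finally show ?case .
  next
    case (eng h1 h2)
    have c: "h1 \<in> carrier G" "h2 \<in> carrier G" "k \<in> carrier G"
      using eng.hyps generate_incl[OF S] that(2) K by auto
    \<comment> \<open>\<open>[h1 h2, k]\<close> is the conjugate of \<open>[h2, k]\<close> by
      \<open>h1\<close>, times \<open>[h1, k]\<close>.\<close>
    have "(h1 \<otimes> (h2 \<otimes> k \<otimes> inv h2 \<otimes> inv k) \<otimes> inv h1) \<otimes> (h1 \<otimes> k \<otimes> inv h1 \<otimes> inv k) \<in> N"
      using N.m_closed N.inv_op_closed2 c eng.IH by simp
    also have "(h1 \<otimes> (h2 \<otimes> k \<otimes> inv h2 \<otimes> inv k) \<otimes> inv h1) \<otimes> (h1 \<otimes> k \<otimes> inv h1 \<otimes> inv k)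
        = h1 \<otimes> h2 \<otimes> k \<otimes> inv (h1 \<otimes> h2) \<otimes> inv k"
      using c by (simp add: inv_mult_group m_assoc inv_mult_cancel)
    finally show ?case .
  qed
  then show ?thesis
    unfolding commutator_subgroup_def
    by (intro generate_subgroup_incl N.is_subgroup) auto
qed

end

section \<open>Inner automorphisms and their conjugation action\<close>

context quandle
begin

sublocale Inn: group "Inn Q"
  by (rule group_Inn)

text \<open>\<open>Inn\<close> is built by generating inside the full permutation group. Generating
  inside \<open>Inn Q\<close> gives the same set, and this form serves induction and commutators
  within \<open>Inn Q\<close>.\<close>

lemma carrier_Inn: "carrier (Inn Q) = generate (Inn Q) (inner_perm Q ` carrier Q)"
proof -
  have "inner_perm Q ` carrier Q \<subseteq> carrier (Inn Q)"
    by (auto simp: Inn_def intro: generate.incl)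
  then show ?thesis
    using group.generate_consistent[OF group_BijGroup _ Inn_subgroup]
    by (simp add: Inn_def)
qed

lemma inner_perm_closed [simp]: "x \<in> carrier Q \<Longrightarrow> inner_perm Q x \<in> carrier (Inn Q)"
  by (auto simp: Inn_def intro: generate.incl)

lemma Inn_BijGroup: "g \<in> carrier (Inn Q) \<Longrightarrow> g \<in> carrier (BijGroup (carrier Q))"
  using subgroup.mem_carrier[OF Inn_subgroup] .

lemma Inn_apply_closed [simp]:
  "\<lbrakk>g \<in> carrier (Inn Q); x \<in> carrier Q\<rbrakk> \<Longrightarrow> g x \<in> carrier Q"
  by (rule BijGroup_apply_closed[OF Inn_BijGroup])

lemma Inn_mult_apply [simp]:
  "\<lbrakk>g \<in> carrier (Inn Q); h \<in> carrier (Inn Q); x \<in> carrier Q\<rbrakk> \<Longrightarrow> (g \<otimes>\<^bsub>Inn Q\<^esub> h) x = g (h x)"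
  using BijGroup_mult_apply[OF Inn_BijGroup Inn_BijGroup] by (simp add: Inn_def)

lemma Inn_one_apply [simp]: "x \<in> carrier Q \<Longrightarrow> \<one>\<^bsub>Inn Q\<^esub> x = x"
  by (simp add: Inn_def BijGroup_one_apply)

lemma Inn_inv_apply [simp]:
  assumes "g \<in> carrier (Inn Q)" "x \<in> carrier Q"
  shows "g ((inv\<^bsub>Inn Q\<^esub> g) x) = x" "(inv\<^bsub>Inn Q\<^esub> g) (g x) = x"
  using assms Inn_mult_apply[of g "inv\<^bsub>Inn Q\<^esub> g" x] Inn_mult_apply[of "inv\<^bsub>Inn Q\<^esub> g" g x]
  by simp_all

lemma Inn_eqI:
  assumes "g \<in> carrier (Inn Q)" "h \<in> carrier (Inn Q)" "\<And>x. x \<in> carrier Q \<Longrightarrow> g x = h x"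
  shows "g = h"
proof (rule extensionalityI)
  show "g \<in> extensional (carrier Q)" "h \<in> extensional (carrier Q)"
    using Inn_BijGroup[OF assms(1)] Inn_BijGroup[OF assms(2)] by (simp_all add: BijGroup_def Bij_def)
qed (rule assms(3))

lemma inner_perm_apply: "y \<in> carrier Q \<Longrightarrow> inner_perm Q x y = pt_sym Q x y"
  by (simp add: inner_perm_def)

lemma pt_sym_closed [simp]: "\<lbrakk>x \<in> carrier Q; y \<in> carrier Q\<rbrakk> \<Longrightarrow> pt_sym Q x y \<in> carrier Q"
  using pt_sym_bij bij_betwE by blast

lemma inner_perm_pt_sym:
  assumes "x \<in> carrier Q" "y \<in> carrier Q" "z \<in> carrier Q"
  shows "inner_perm Q x (pt_sym Q y z) = pt_sym Q (inner_perm Q x y) (inner_perm Q x z)"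
  using assms pt_sym_distrib[OF assms] by (simp add: inner_perm_apply)

text \<open>Self-distributivity gives this for each \<open>s_x\<close>, and it passes to inverses
  and composites.\<close>

lemma Inn_pt_sym:
  assumes "g \<in> carrier (Inn Q)" "x \<in> carrier Q" "y \<in> carrier Q"
  shows "g (pt_sym Q x y) = pt_sym Q (g x) (g y)"
proof -
  have "g \<in> generate (Inn Q) (inner_perm Q ` carrier Q)"
    using assms(1) unfolding carrier_Inn .
  then have "\<forall>x\<in>carrier Q. \<forall>y\<in>carrier Q. g (pt_sym Q x y) = pt_sym Q (g x) (g y)"
  proof induction
    case one
    then show ?case by simp
  next
    case (incl h)
    then show ?case using inner_perm_pt_sym by blast
  next
    case (inv h)
    then obtain z where z: "z \<in> carrier Q" "h = inner_perm Q z" by blast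
    then have hc: "h \<in> carrier (Inn Q)" by simp
    let ?k = "inv\<^bsub>Inn Q\<^esub> h"
    have kc: "?k \<in> carrier (Inn Q)" using hc by simp
    show ?case
    proof (intro ballI)
      fix x y assume xy: "x \<in> carrier Q" "y \<in> carrier Q"
      \<comment> \<open>The property of \<open>h\<close> is used at the preimages of
        \<open>x\<close> and \<open>y\<close>; applying \<open>?k\<close> to both sides then removes
        \<open>h\<close>.\<close>
      have "h (pt_sym Q (?k x) (?k y)) = pt_sym Q (h (?k x)) (h (?k y))"
        unfolding z(2) by (rule inner_perm_pt_sym) (use z kc xy in auto)
      also have "\<dots> = pt_sym Q x y" using hc xy by simp
      finally show "?k (pt_sym Q x y) = pt_sym Q (?k x) (?k y)"
        using Inn_inv_apply(2)[OF hc, of "pt_sym Q (?k x) (?k y)"] kc xy by simp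
    qed
  next
    case (eng h1 h2)
    then show ?case by (simp flip: carrier_Inn)
  qed
  then show ?thesis using assms by blast
qed

text \<open>Since \<open>g\<close> preserves the operation, composing \<open>g\<close> after
  \<open>s_x\<close> or before \<open>s_(g x)\<close> sends \<open>y\<close> to
  \<open>pt_sym Q (g x) (g y)\<close> either way.\<close>

lemma Inn_conj_inner_perm:
  assumes "g \<in> carrier (Inn Q)" "x \<in> carrier Q"
  shows "g \<otimes>\<^bsub>Inn Q\<^esub> inner_perm Q x \<otimes>\<^bsub>Inn Q\<^esub> inv\<^bsub>Inn Q\<^esub> g = inner_perm Q (g x)"
proof -
  have "g \<otimes>\<^bsub>Inn Q\<^esub> inner_perm Q x = inner_perm Q (g x) \<otimes>\<^bsub>Inn Q\<^esub> g"
    using assms by (intro Inn_eqI) (simp_all add: inner_perm_apply Inn_pt_sym)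
  then show ?thesis using assms by (simp add: Inn.m_assoc)
qed

end

section \<open>The kernel of the induced map and relative transvections\<close>

locale surjective_quandle_hom = quandle_hom +
  assumes surj: "f ` carrier P = carrier Q"
begin

lemma Inn_map_spec:
  assumes "g \<in> carrier (Inn P)"
  shows "Inn_map P Q f g \<in> carrier (Inn Q)"
    and "x \<in> carrier P \<Longrightarrow> f (g x) = Inn_map P Q f g (f x)"
  using theI'[OF Inn_map_unique[OF surj assms]] unfolding Inn_map_def by blast+

text \<open>As \<open>f\<close> is surjective, \<open>Inn_map P Q f g\<close> is determined by its
  values at the points \<open>f x\<close>, so it is trivial exactly when \<open>g\<close> preserves
  every fiber.\<close>

lemma Inn_rel_eq: "Inn_rel P Q f = {g \<in> carrier (Inn P). \<forall>x\<in>carrier P. f (g x) = f x}"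
proof -
  have "Inn_map P Q f g = \<one>\<^bsub>Inn Q\<^esub> \<longleftrightarrow> (\<forall>x\<in>carrier P. f (g x) = f x)"
    if g: "g \<in> carrier (Inn P)" for g
  proof
    assume "Inn_map P Q f g = \<one>\<^bsub>Inn Q\<^esub>"
    then show "\<forall>x\<in>carrier P. f (g x) = f x"
      using Inn_map_spec(2)[OF g] f_closed by (auto simp: Pi_iff)
  next
    assume *: "\<forall>x\<in>carrier P. f (g x) = f x"
    show "Inn_map P Q f g = \<one>\<^bsub>Inn Q\<^esub>"
    proof (rule Q.Inn_eqI)
      fix y assume "y \<in> carrier Q"
      then obtain x where "x \<in> carrier P" "y = f x" using surj by blast
      then show "Inn_map P Q f g y = \<one>\<^bsub>Inn Q\<^esub> y"
        using Inn_map_spec(2)[OF g] * \<open>y \<in> carrier Q\<close> by simp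
    qed (simp_all add: Inn_map_spec(1)[OF g])
  qed
  then show ?thesis by (auto simp: Inn_rel_def kernel_def)
qed

lemma Inn_rel_subgroup: "subgroup (Inn_rel P Q f) (Inn P)"
proof (rule P.Inn.subgroupI)
  show "Inn_rel P Q f \<noteq> {}"
    using P.Inn.one_closed by (auto simp: Inn_rel_eq)
next
  fix g assume g: "g \<in> Inn_rel P Q f"
  have "f ((inv\<^bsub>Inn P\<^esub> g) x) = f x" if "x \<in> carrier P" for x
  proof -
    \<comment> \<open>Membership of \<open>g\<close> is applied at the point \<open>inv g x\<close>,
      so \<open>g (inv g x)\<close> must not collapse to \<open>x\<close> beforehand.\<close>
    have "f (g ((inv\<^bsub>Inn P\<^esub> g) x)) = f ((inv\<^bsub>Inn P\<^esub> g) x)"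
      using g that by (simp add: Inn_rel_eq del: P.Inn_inv_apply)
    then show ?thesis using g that by (simp add: Inn_rel_eq)
  qed
  then show "inv\<^bsub>Inn P\<^esub> g \<in> Inn_rel P Q f"
    using g by (simp add: Inn_rel_eq)
qed (auto simp: Inn_rel_eq)

lemma f_Inn_cong:
  assumes "g \<in> carrier (Inn P)" "x \<in> carrier P" "y \<in> carrier P" "f x = f y"
  shows "f (g x) = f (g y)"
  using Inn_map_spec(2)[OF assms(1)] assms by simp

text \<open>Conjugation by \<open>g\<close> turns the generator for \<open>x\<close>,
  \<open>y\<close> into the one for \<open>g x\<close>, \<open>g y\<close>, which again share a
  fiber by \<open>f_Inn_cong\<close>.\<close>

lemma Trans_rel_normal: "Trans_rel P f \<lhd> Inn P"
  unfolding Trans_rel_def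
proof (rule P.Inn.normal_generateI)
  fix h g
  assume "h \<in> {inner_perm P x \<otimes>\<^bsub>Inn P\<^esub> inv\<^bsub>Inn P\<^esub> (inner_perm P y) | x y.
      x \<in> carrier P \<and> y \<in> carrier P \<and> f x = f y}" and g: "g \<in> carrier (Inn P)"
  then obtain x y where xy: "x \<in> carrier P" "y \<in> carrier P" "f x = f y"
    and h: "h = inner_perm P x \<otimes>\<^bsub>Inn P\<^esub> inv\<^bsub>Inn P\<^esub> (inner_perm P y)" by blast
  have "g \<otimes>\<^bsub>Inn P\<^esub> h \<otimes>\<^bsub>Inn P\<^esub> inv\<^bsub>Inn P\<^esub> g
      = (g \<otimes>\<^bsub>Inn P\<^esub> inner_perm P x \<otimes>\<^bsub>Inn P\<^esub> inv\<^bsub>Inn P\<^esub> g)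
        \<otimes>\<^bsub>Inn P\<^esub> inv\<^bsub>Inn P\<^esub> (g \<otimes>\<^bsub>Inn P\<^esub> inner_perm P y \<otimes>\<^bsub>Inn P\<^esub> inv\<^bsub>Inn P\<^esub> g)"
    using g xy h by (simp add: P.Inn.m_assoc P.Inn.inv_mult_group P.Inn.inv_mult_cancel)
  also have "\<dots> = inner_perm P (g x) \<otimes>\<^bsub>Inn P\<^esub> inv\<^bsub>Inn P\<^esub> (inner_perm P (g y))"
    using g xy by (simp add: P.Inn_conj_inner_perm)
  finally show "g \<otimes>\<^bsub>Inn P\<^esub> h \<otimes>\<^bsub>Inn P\<^esub> inv\<^bsub>Inn P\<^esub> g \<in>
      {inner_perm P x \<otimes>\<^bsub>Inn P\<^esub> inv\<^bsub>Inn P\<^esub> (inner_perm P y) | x y.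
      x \<in> carrier P \<and> y \<in> carrier P \<and> f x = f y}"
    using f_Inn_cong[OF g xy] P.Inn_apply_closed[OF g xy(1)] P.Inn_apply_closed[OF g xy(2)] by blast
qed auto

text \<open>\<open>f (s_x w)\<close> depends on \<open>x\<close> only through \<open>f x\<close>, so
  under \<open>f\<close> the factors \<open>s_x\<close> and \<open>inv s_y\<close> cancel.\<close>

lemma Trans_rel_subset: "Trans_rel P f \<subseteq> Inn_rel P Q f"
  unfolding Trans_rel_def
proof (intro P.Inn.generate_subgroup_incl Inn_rel_subgroup subsetI)
  fix h assume "h \<in> {inner_perm P x \<otimes>\<^bsub>Inn P\<^esub> inv\<^bsub>Inn P\<^esub> (inner_perm P y) | x y.
      x \<in> carrier P \<and> y \<in> carrier P \<and> f x = f y}"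
  then obtain x y where xy: "x \<in> carrier P" "y \<in> carrier P" "f x = f y"
    and h: "h = inner_perm P x \<otimes>\<^bsub>Inn P\<^esub> inv\<^bsub>Inn P\<^esub> (inner_perm P y)" by blast
  have "f (h z) = f z" if z: "z \<in> carrier P" for z
  proof -
    define w where "w = (inv\<^bsub>Inn P\<^esub> (inner_perm P y)) z"
    have w: "w \<in> carrier P" "inner_perm P y w = z"
      using xy z by (simp_all add: w_def)
    have "f (h z) = f (pt_sym P x w)"
      using xy z w(1) by (simp add: h P.inner_perm_apply flip: w_def)
    also have "\<dots> = f (pt_sym P y w)" using xy w(1) by (simp add: f_pt_sym)
    also have "\<dots> = f z" using w by (simp add: P.inner_perm_apply)
    finally show ?thesis .
  qed
  then show "h \<in> Inn_rel P Q f" using xy h by (simp add: Inn_rel_eq)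
qed

lemma commutator_subset_Trans_rel:
  "commutator_subgroup (Inn P) (carrier (Inn P)) (Inn_rel P Q f) \<subseteq> Trans_rel P f"
  \<comment> \<open>With the carrier written as a generated subgroup, only commutators with the
    generators \<open>s_x\<close> remain.\<close>
  unfolding P.carrier_Inn
proof (rule P.Inn.commutator_subset_normal)
  fix s k assume "s \<in> inner_perm P ` carrier P" and k: "k \<in> Inn_rel P Q f"
  then obtain x where x: "x \<in> carrier P" and s: "s = inner_perm P x" by blast
  have kc: "k \<in> carrier (Inn P)" "f (k x) = f x" using k x by (auto simp: Inn_rel_eq)
  \<comment> \<open>Regrouping exposes a conjugate of \<open>s\<close> by \<open>k\<close>.\<close>
  have "s \<otimes>\<^bsub>Inn P\<^esub> k \<otimes>\<^bsub>Inn P\<^esub> inv\<^bsub>Inn P\<^esub> s \<otimes>\<^bsub>Inn P\<^esub> inv\<^bsub>Inn P\<^esub> k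
      = s \<otimes>\<^bsub>Inn P\<^esub> inv\<^bsub>Inn P\<^esub> (k \<otimes>\<^bsub>Inn P\<^esub> s \<otimes>\<^bsub>Inn P\<^esub> inv\<^bsub>Inn P\<^esub> k)"
    using x s kc by (simp add: P.Inn.m_assoc P.Inn.inv_mult_group)
  also have "\<dots> = inner_perm P x \<otimes>\<^bsub>Inn P\<^esub> inv\<^bsub>Inn P\<^esub> (inner_perm P (k x))"
    using x s kc by (simp add: P.Inn_conj_inner_perm)
  also have "\<dots> \<in> Trans_rel P f"
    unfolding Trans_rel_def using x kc by (intro generate.incl) force
  finally show "s \<otimes>\<^bsub>Inn P\<^esub> k \<otimes>\<^bsub>Inn P\<^esub> inv\<^bsub>Inn P\<^esub> s \<otimes>\<^bsub>Inn P\<^esub> inv\<^bsub>Inn P\<^esub> k \<in> Trans_rel P f" .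
qed (use Trans_rel_normal subgroup.subset[OF Inn_rel_subgroup] in auto)

end

section \<open>Transitivity on fibers and equality of the two subgroups\<close>

context connected_quandle_hom
begin

sublocale surjective_quandle_hom
  by unfold_locales (rule f_surj)

text \<open>The action is by restriction to the fiber of \<open>f x\<close>; as \<open>y\<close>
  lies in it, the restricted map and \<open>g\<close> agree at \<open>y\<close>.\<close>

lemma fiber_transitiveD:
  assumes "x \<in> carrier P" "y \<in> carrier P" "f x = f y"
  obtains g where "g \<in> Inn_rel P Q f" "g y = x"
proof -
  interpret transitive_action "Inn_rel_group P Q f" "fiber P f (f x)"
    "\<lambda>\<phi>. restrict \<phi> (fiber P f (f x))"
    using fiber_transitive assms f_closed by blast
  have "x \<in> fiber P f (f x)" "y \<in> fiber P f (f x)"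
    using assms by (auto simp: fiber_def)
  then show ?thesis
    using unique_orbit[of y x] that by (auto simp: Inn_rel_group_def)
qed

lemma Trans_rel_subset_commutator:
  "Trans_rel P f \<subseteq> commutator_subgroup (Inn P) (carrier (Inn P)) (Inn_rel P Q f)"
proof -
  let ?C = "{h \<otimes>\<^bsub>Inn P\<^esub> k \<otimes>\<^bsub>Inn P\<^esub> inv\<^bsub>Inn P\<^esub> h \<otimes>\<^bsub>Inn P\<^esub> inv\<^bsub>Inn P\<^esub> k | h k.
    h \<in> carrier (Inn P) \<and> k \<in> Inn_rel P Q f}"
  have C: "?C \<subseteq> carrier (Inn P)"
    using subgroup.subset[OF Inn_rel_subgroup] by blast
  show ?thesis
    unfolding Trans_rel_def commutator_subgroup_def
  proof (intro P.Inn.generate_subgroup_incl P.Inn.generate_is_subgroup C subsetI)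
    fix t assume "t \<in> {inner_perm P x \<otimes>\<^bsub>Inn P\<^esub> inv\<^bsub>Inn P\<^esub> (inner_perm P y) | x y.
        x \<in> carrier P \<and> y \<in> carrier P \<and> f x = f y}"
    then obtain x y where xy: "x \<in> carrier P" "y \<in> carrier P" "f x = f y"
      and t: "t = inner_perm P x \<otimes>\<^bsub>Inn P\<^esub> inv\<^bsub>Inn P\<^esub> (inner_perm P y)" by blast
    obtain g where g: "g \<in> Inn_rel P Q f" "g y = x"
      using fiber_transitiveD[OF xy] .
    let ?s = "inner_perm P y"
    have gc: "g \<in> carrier (Inn P)" using g(1) by (simp add: Inn_rel_eq)
    have "t = g \<otimes>\<^bsub>Inn P\<^esub> ?s \<otimes>\<^bsub>Inn P\<^esub> inv\<^bsub>Inn P\<^esub> g \<otimes>\<^bsub>Inn P\<^esub> inv\<^bsub>Inn P\<^esub> ?s"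
      using P.Inn_conj_inner_perm[OF gc xy(2)] g(2) t by simp
    \<comment> \<open>Commutators in \<open>?C\<close> have the element of \<open>Inn_rel\<close> in
      the second slot, while \<open>g\<close> stands first; hence the inverse.\<close>
    also have "\<dots> = inv\<^bsub>Inn P\<^esub> (?s \<otimes>\<^bsub>Inn P\<^esub> g \<otimes>\<^bsub>Inn P\<^esub> inv\<^bsub>Inn P\<^esub> ?s \<otimes>\<^bsub>Inn P\<^esub> inv\<^bsub>Inn P\<^esub> g)"
      using gc xy by (simp add: P.Inn.m_assoc P.Inn.inv_mult_group)
    also have "\<dots> \<in> generate (Inn P) ?C"
      using g(1) xy(2) by (intro generate.inv) force
    finally show "t \<in> generate (Inn P) ?C" .
  qed
qed

lemma commutator_eq_Trans_rel:
  "commutator_subgroup (Inn P) (carrier (Inn P)) (Inn_rel P Q f) = Trans_rel P f"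
  using commutator_subset_Trans_rel Trans_rel_subset_commutator by blast

end

theorem proposition3p27:
  fixes P :: "('a, 'm) quandle_struct_scheme" and Q :: "('b, 'n) quandle_struct_scheme"
    and f :: "'a \<Rightarrow> 'b"
  assumes "connected_quandle_hom P Q f"
  shows "natural_map (Inn_rel_group P Q f)
           (commutator_subgroup (Inn P) (carrier (Inn P)) (Inn_rel P Q f)) (Trans_rel P f)
         \<in> iso (Inn_rel_group P Q f Mod
                 commutator_subgroup (Inn P) (carrier (Inn P)) (Inn_rel P Q f))
               (H_quot P Q f)
         \<and> (trivial_group (H_quot P Q f) \<longleftrightarrow> relatively_perfect (Inn P) (Inn_rel P Q f))"
proof -
  interpret connected_quandle_hom P Q f by fact
  interpret R: group "Inn_rel_group P Q f"
    using P.Inn.subgroup_imp_group[OF Inn_rel_subgroup] by (simp add: Inn_rel_group_def)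
  have T: "Trans_rel P f \<lhd> Inn_rel_group P Q f"
    using P.Inn.normal_restrict_supergroup[OF Inn_rel_subgroup Trans_rel_normal Trans_rel_subset]
    by (simp add: Inn_rel_group_def)
  \<comment> \<open>Rewriting with \<open>commutator_eq_Trans_rel\<close> makes both quotients the
    same and turns relative perfectness into \<open>Trans_rel P f = Inn_rel P Q f\<close>.\<close>
  show ?thesis
    using R.natural_map_refl_iso[OF T] R.trivial_group_Mod_iff[OF T]
    by (simp add: commutator_eq_Trans_rel H_quot_def relatively_perfect_def Inn_rel_group_def)
qed

end
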